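(* Let $\langle A,\rightarrow,\vee,1\rangle$ be an algebra of type $(2,2,0)$. The following conditions are equivalent: (i) $\langle A,\rightarrow,\vee,1\rangle$ is an $H^{\vee}$-algebra; (ii) $\langle A,\rightarrow,1\rangle$ is a Hilbert algebra and the following equations hold for all $x,y,z\in A$: (a) $x\rightarrow(x\vee y)=1$, (b) $y\rightarrow(x\vee y)=1$, (c) $(x\rightarrow z)\rightarrow((y\rightarrow z)\rightarrow((x\vee y)\rightarrow z))=1$.
   Context: A Hilbert algebra is an algebra $\langle A,\rightarrow,1\rangle$ of type $(2,0)$ such that for all $x,y,z\in A$: $x\rightarrow(y\rightarrow x)=1$; $(x\rightarrow(y\rightarrow z))\rightarrow((x\rightarrow y)\rightarrow(x\rightarrow z))=1$; and $x\rightarrow y=1=y\rightarrow x$ implies $x=y$. A Hilbert algebra with supremum (or $H^{\vee}$-algebra) is an algebra $\langle A,\rightarrow,\vee,1\rangle$ of type $(2,2,0)$ such that $\langle A,\rightarrow,1\rangle$ is a Hilbert algebra, $\langle A,\vee,1\rangle$ is a join-semilattice (i.e. $\vee$ is associative, commutative and idempotent) with greatest element $1$, and for all $a,b\in A$: $a\rightarrow b=1$ if and only if $a\vee b=b$. *)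

theory Defs
  imports Main
begin

text \<open>The carrier of an algebra is its whole type; the operations are arbitrary total functions on it.\<close>

locale hilbert_algebra =
  fixes imp :: "'a \<Rightarrow> 'a \<Rightarrow> 'a" (infixr "\<rightarrow>" 60)
    and one :: 'a
  assumes imp_K: "x \<rightarrow> (y \<rightarrow> x) = one"
    and imp_S: "(x \<rightarrow> (y \<rightarrow> z)) \<rightarrow> ((x \<rightarrow> y) \<rightarrow> (x \<rightarrow> z)) = one"
    and imp_antisym: "x \<rightarrow> y = one \<Longrightarrow> y \<rightarrow> x = one \<Longrightarrow> x = y"

text \<open>
  The order of a join-semilattice is given by \<open>x \<le> y\<close> iff \<open>x \<squnion> y = y\<close>, so \<open>join_one\<close> says
  that \<open>one\<close> is its greatest element.
\<close>

locale hilbert_algebra_sup =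
  hilbert_algebra imp one + join: semilattice join
  for imp :: "'a \<Rightarrow> 'a \<Rightarrow> 'a" (infixr "\<rightarrow>" 60)
    and join :: "'a \<Rightarrow> 'a \<Rightarrow> 'a" (infixl "\<squnion>" 65)
    and one :: 'a +
  assumes join_one: "x \<squnion> one = one"
    and imp_eq_one_iff: "a \<rightarrow> b = one \<longleftrightarrow> a \<squnion> b = b"

end

theory Submission
  imports Defs
begin

text \<open>
  In a Hilbert algebra the relation \<open>x \<rightarrow> y = 1\<close> is a partial order with greatest element \<open>1\<close>.
  Since premises may be exchanged, (c) says that \<open>x \<squnion> y\<close> lies below
  \<open>(x \<rightarrow> z) \<rightarrow> ((y \<rightarrow> z) \<rightarrow> z)\<close>, which is an upper bound of \<open>x\<close> and \<open>y\<close>. Conversely, (a), (b)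
  and (c) with modus ponens make \<open>x \<squnion> y\<close> the least upper bound of \<open>x\<close> and \<open>y\<close>, so \<open>\<squnion>\<close> is the
  join of this order.
\<close>

context hilbert_algebra
begin

text \<open>The second assumption becomes \<open>one \<rightarrow> y = one\<close>, which turns the
  K axiom \<open>y \<rightarrow> (one \<rightarrow> y) = one\<close> into
  \<open>y \<rightarrow> one = one\<close>; antisymmetry then applies.\<close>

lemma modus_ponens:
  assumes "x = one" and "x \<rightarrow> y = one"
  shows "y = one"
proof (rule imp_antisym)
  show "y \<rightarrow> one = one"
    using imp_K[of y one] assms by simp
  show "one \<rightarrow> y = one"
    using assms by simp
qed

lemma imp_weaken: "y = one \<Longrightarrow> x \<rightarrow> y = one"
  using modus_ponens[OF _ imp_K] .

text \<open>S with both premises detached: modus ponens under the premise \<open>x\<close>.\<close>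

lemma imp_mp: "x \<rightarrow> (y \<rightarrow> z) = one \<Longrightarrow> x \<rightarrow> y = one \<Longrightarrow> x \<rightarrow> z = one"
  by (rule modus_ponens[OF _ modus_ponens[OF _ imp_S]])

text \<open>The combinator identity S K K = I.\<close>

lemma imp_refl: "x \<rightarrow> x = one"
  by (rule imp_mp[OF imp_K imp_K])

lemma imp_trans: "x \<rightarrow> y = one \<Longrightarrow> y \<rightarrow> z = one \<Longrightarrow> x \<rightarrow> z = one"
  by (rule imp_mp[OF imp_weaken])

lemma imp_mono: "y \<rightarrow> z = one \<Longrightarrow> (x \<rightarrow> y) \<rightarrow> (x \<rightarrow> z) = one"
  by (rule modus_ponens[OF imp_weaken imp_S])

lemma imp_exchange:
  assumes "x \<rightarrow> (y \<rightarrow> z) = one"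
  shows "y \<rightarrow> (x \<rightarrow> z) = one"
  by (rule imp_trans[OF imp_K modus_ponens[OF assms imp_S]])

text \<open>Exchange as an inequality, so that it can be chained by \<open>imp_trans\<close> below a
  further premise.\<close>

lemma imp_exchange_le: "(x \<rightarrow> (y \<rightarrow> z)) \<rightarrow> (y \<rightarrow> (x \<rightarrow> z)) = one"
proof -
  \<comment> \<open>S with its premises exchanged starts from \<open>x \<rightarrow> y\<close>,
    which lies above \<open>y\<close> by K.\<close>
  have "y \<rightarrow> ((x \<rightarrow> (y \<rightarrow> z)) \<rightarrow> (x \<rightarrow> z)) = one"
    by (rule imp_trans[OF imp_K imp_exchange[OF imp_S]])
  then show ?thesis
    by (rule imp_exchange)
qed

lemma imp_apply: "x \<rightarrow> ((x \<rightarrow> y) \<rightarrow> y) = one"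
  by (rule imp_exchange[OF imp_refl])

end

context hilbert_algebra_sup
begin

lemma imp_join1: "x \<rightarrow> (x \<squnion> y) = one"
  by (simp add: imp_eq_one_iff)

lemma imp_join2: "y \<rightarrow> (x \<squnion> y) = one"
  by (simp add: imp_eq_one_iff join.left_commute)

lemma join_imp_least: "x \<rightarrow> z = one \<Longrightarrow> y \<rightarrow> z = one \<Longrightarrow> (x \<squnion> y) \<rightarrow> z = one"
  by (simp add: imp_eq_one_iff join.assoc)

lemma join_imp: "(x \<rightarrow> z) \<rightarrow> ((y \<rightarrow> z) \<rightarrow> ((x \<squnion> y) \<rightarrow> z)) = one"
proof -
  let ?w = "(x \<rightarrow> z) \<rightarrow> ((y \<rightarrow> z) \<rightarrow> z)"
  \<comment> \<open>\<open>x\<close> lies below \<open>(x \<rightarrow> z) \<rightarrow> z\<close>,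
    and K enlarges the last \<open>z\<close> to
    \<open>(y \<rightarrow> z) \<rightarrow> z\<close>.\<close>
  have "x \<rightarrow> ?w = one"
    by (rule imp_trans[OF imp_apply imp_mono[OF imp_K]])
  moreover have "y \<rightarrow> ?w = one"
    by (rule imp_trans[OF imp_apply imp_K])
  ultimately have "(x \<squnion> y) \<rightarrow> ?w = one"
    by (rule join_imp_least)
  then have "(x \<rightarrow> z) \<rightarrow> ((x \<squnion> y) \<rightarrow> ((y \<rightarrow> z) \<rightarrow> z)) = one"
    by (rule imp_exchange)
  \<comment> \<open>The premises \<open>x \<squnion> y\<close> and \<open>y \<rightarrow> z\<close>
    trade places under \<open>x \<rightarrow> z\<close>, where the rule \<open>imp_exchange\<close>
    does not reach.\<close>
  then show ?thesis
    using imp_exchange_le by (rule imp_trans)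
qed

end

lemma (in hilbert_algebra) hilbert_algebra_supI:
  fixes join :: "'a \<Rightarrow> 'a \<Rightarrow> 'a" (infixl "\<squnion>" 65)
  assumes upper1: "\<And>x y. x \<rightarrow> (x \<squnion> y) = one"
    and upper2: "\<And>x y. y \<rightarrow> (x \<squnion> y) = one"
    and join_imp: "\<And>x y z. (x \<rightarrow> z) \<rightarrow> ((y \<rightarrow> z) \<rightarrow> ((x \<squnion> y) \<rightarrow> z)) = one"
  shows "hilbert_algebra_sup imp join one"
proof -
  have least: "(x \<squnion> y) \<rightarrow> z = one" if "x \<rightarrow> z = one" "y \<rightarrow> z = one" for x y z
    by (rule modus_ponens[OF that(2) modus_ponens[OF that(1) join_imp]])
  show ?thesis
  proof unfold_locales
    fix a b c
    show "a \<squnion> b \<squnion> c = a \<squnion> (b \<squnion> c)"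
      \<comment> \<open>Both sides are least upper bounds of \<open>a\<close>, \<open>b\<close> and
        \<open>c\<close>; the four chains are the ways up through two nested joins.\<close>
      by (rule imp_antisym; intro least upper1 upper2
          imp_trans[OF upper1 upper1] imp_trans[OF upper2 upper1]
          imp_trans[OF upper1 upper2] imp_trans[OF upper2 upper2])
    show "a \<squnion> b = b \<squnion> a"
      by (rule imp_antisym; intro least upper1 upper2)
    show "a \<squnion> a = a"
      by (rule imp_antisym; intro least upper1 imp_refl)
    show "a \<squnion> one = one"
      by (rule imp_antisym[OF imp_weaken[OF refl] upper2])
    show "a \<rightarrow> b = one \<longleftrightarrow> a \<squnion> b = b"
    proof
      assume "a \<rightarrow> b = one"
      then show "a \<squnion> b = b"
        by (rule imp_antisym[OF least[OF _ imp_refl] upper2])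
    next
      assume "a \<squnion> b = b"
      then show "a \<rightarrow> b = one"
        using upper1[of a b] by simp
    qed
  qed
qed

theorem theorem3p1:
  fixes imp :: "'a \<Rightarrow> 'a \<Rightarrow> 'a" (infixr "\<rightarrow>" 60)
    and join :: "'a \<Rightarrow> 'a \<Rightarrow> 'a" (infixl "\<squnion>" 65)
    and one :: 'a
  shows "hilbert_algebra_sup imp join one \<longleftrightarrow>
    hilbert_algebra imp one \<and>
    (\<forall>x y. x \<rightarrow> (x \<squnion> y) = one) \<and>
    (\<forall>x y. y \<rightarrow> (x \<squnion> y) = one) \<and>
    (\<forall>x y z. (x \<rightarrow> z) \<rightarrow> ((y \<rightarrow> z) \<rightarrow> ((x \<squnion> y) \<rightarrow> z)) = one)"
proof (intro iffI)
  assume "hilbert_algebra_sup imp join one"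
  then interpret hilbert_algebra_sup imp join one .
  show "hilbert_algebra imp one \<and>
    (\<forall>x y. x \<rightarrow> (x \<squnion> y) = one) \<and>
    (\<forall>x y. y \<rightarrow> (x \<squnion> y) = one) \<and>
    (\<forall>x y z. (x \<rightarrow> z) \<rightarrow> ((y \<rightarrow> z) \<rightarrow> ((x \<squnion> y) \<rightarrow> z)) = one)"
    by (intro conjI allI hilbert_algebra_axioms imp_join1 imp_join2 join_imp)
qed (elim conjE, rule hilbert_algebra.hilbert_algebra_supI, simp_all)

end
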